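(* Let $\alpha\in(0,1)$. Let $F:\mathbb{R}^n\to\mathbb{R}^n$ be a continuous $\alpha$-averaged operator with $\mathcal{F}_F\neq\emptyset$ and $F$ not the identity. Let $R>0$ and define $\tilde\rho_F\in[0,1]$ and $\tilde K_F\in\mathbb{R}\cup\{\infty\}$ by $$\tilde\rho_F=\sup_{x:\,0<\operatorname{dist}(x,\mathcal{F}_F)\le R}\frac{\operatorname{dist}(F(x),\mathcal{F}_F)}{\operatorname{dist}(x,\mathcal{F}_F)},\qquad\tilde K_F=\sup_{x:\,0<\operatorname{dist}(x,\mathcal{F}_F)\le R}\frac{\operatorname{dist}(x,\mathcal{F}_F)}{\|F(x)-x\|},$$ that is, the tightest constants such that, respectively, for all $x$ with $\operatorname{dist}(x,\mathcal{F}_F)\le R$, $\operatorname{dist}(F(x),\mathcal{F}_F)\le\tilde\rho_F\operatorname{dist}(x,\mathcal{F}_F)$, and $\operatorname{dist}(x,\mathcal{F}_F)\le\tilde K_F\|F(x)-x\|$. Then the following equivalent relations hold: $$1-\frac{1}{\tilde K_F}\le\tilde\rho_F\le\sqrt{1-\frac{1-\alpha}{\alpha\tilde K_F^2}}\qquad\text{and}\qquad\sqrt{\frac{1-\alpha}{\alpha(1-\tilde\rho_F^2)}}\le\tilde K_F\le\frac{1}{1-\tilde\rho_F}.$$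
   Context: $\|\cdot\|$ is the Euclidean norm, $\operatorname{dist}(x,S)=\inf_{y\in S}\|x-y\|$, $\mathcal{F}_F:=\{x:F(x)=x\}$. $N:\mathbb{R}^n\to\mathbb{R}^n$ is nonexpansive if $\|N(x)-N(y)\|\le\|x-y\|$ for all $x,y$; $F$ is $\alpha$-averaged if $F(x)=(1-\alpha)x+\alpha N(x)$ for all $x$, for some nonexpansive $N$. Conventions: $1/\infty=0$, and a positive number divided by $0$ is $\infty$. *)

theory Defs
  imports "HOL-Analysis.Analysis"
begin

definition nonexpansive :: "('a::real_normed_vector \<Rightarrow> 'a) \<Rightarrow> bool" where
  "nonexpansive N \<longleftrightarrow> (\<forall>x y. norm (N x - N y) \<le> norm (x - y))"

definition averaged :: "real \<Rightarrow> ('a::real_normed_vector \<Rightarrow> 'a) \<Rightarrow> bool" where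
  "averaged \<alpha> F \<longleftrightarrow> (\<exists>N. nonexpansive N \<and> (\<forall>x. F x = (1 - \<alpha>) *\<^sub>R x + \<alpha> *\<^sub>R N x))"

definition fixed_points :: "('a \<Rightarrow> 'a) \<Rightarrow> 'a set" where
  "fixed_points F = {x. F x = x}"

text \<open>
  Both moduli are suprema in the extended reals, so that they may be infinite and no
  boundedness has to be presupposed. Division on \<^typ>\<open>ereal\<close> already obeys the
  conventions used below: a number divided by \<open>\<infinity>\<close> is 0, and a positive number
  divided by 0 is \<open>\<infinity>\<close>. For a nonempty set, \<^const>\<open>infdist\<close> is the usual infimum.
\<close>

definition contraction_modulus :: "('a::real_normed_vector \<Rightarrow> 'a) \<Rightarrow> real \<Rightarrow> ereal" where
  "contraction_modulus F R =
     (SUP x\<in>{x. 0 < infdist x (fixed_points F) \<and> infdist x (fixed_points F) \<le> R}.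
        ereal (infdist (F x) (fixed_points F)) / ereal (infdist x (fixed_points F)))"

definition error_bound_modulus :: "('a::real_normed_vector \<Rightarrow> 'a) \<Rightarrow> real \<Rightarrow> ereal" where
  "error_bound_modulus F R =
     (SUP x\<in>{x. 0 < infdist x (fixed_points F) \<and> infdist x (fixed_points F) \<le> R}.
        ereal (infdist x (fixed_points F)) / ereal (norm (F x - x)))"

text \<open>
  Square root on the extended reals. Like the real \<^const>\<open>sqrt\<close>, it is odd, so a
  negative argument yields a negative value; in particular an inequality
  \<open>0 \<le> r \<le> esqrt x\<close> entails \<open>0 \<le> x\<close>.
\<close>

definition esqrt :: "ereal \<Rightarrow> ereal" where
  "esqrt x = (case x of ereal r \<Rightarrow> ereal (sqrt r) | PInfty \<Rightarrow> \<infinity> | MInfty \<Rightarrow> -\<infinity>)"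

lemma esqrt_simps [simp]:
  "esqrt (ereal r) = ereal (sqrt r)"
  "esqrt \<infinity> = \<infinity>"
  "esqrt (-\<infinity>) = -\<infinity>"
  by (simp_all add: esqrt_def ereal.case)

text \<open>
  The moduli are the tightest constants in the corresponding inequalities over all
  points of distance at most \<open>R\<close> from the fixed points, including the fixed points.
\<close>

lemma infdist_pos_imp_not_fixed:
  assumes "0 < infdist x (fixed_points F)"
  shows "0 < norm (F x - x)"
proof (rule ccontr)
  assume "\<not> 0 < norm (F x - x)"
  then have "x \<in> fixed_points F" by (simp add: fixed_points_def)
  then show False using assms by simp
qed

lemma infdist_zero_imp_fixed:
  fixes F :: "'a::real_normed_vector \<Rightarrow> 'a"
  assumes "continuous_on UNIV F" "fixed_points F \<noteq> {}" "infdist x (fixed_points F) = 0"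
  shows "F x = x"
proof -
  have "closed (fixed_points F)"
    unfolding fixed_points_def by (intro closed_Collect_eq assms(1) continuous_on_id)
  then have "x \<in> fixed_points F"
    using assms in_closed_iff_infdist_zero by blast
  then show ?thesis by (simp add: fixed_points_def)
qed

lemma contraction_modulus_upper:
  assumes "continuous_on UNIV F" "fixed_points F \<noteq> {}" "infdist x (fixed_points F) \<le> R"
  shows "ereal (infdist (F x) (fixed_points F))
           \<le> contraction_modulus F R * ereal (infdist x (fixed_points F))"
proof (cases "infdist x (fixed_points F) = 0")
  case True
  then show ?thesis using infdist_zero_imp_fixed[OF assms(1,2) True] by (simp flip: zero_ereal_def)
next
  case False
  then have pos: "0 < infdist x (fixed_points F)"
    using infdist_nonneg[of x "fixed_points F"] by linarith
  have "ereal (infdist (F x) (fixed_points F)) / ereal (infdist x (fixed_points F))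
          \<le> contraction_modulus F R"
    unfolding contraction_modulus_def by (rule SUP_upper) (use pos assms in auto)
  then show ?thesis
    using pos by (subst (asm) ereal_divide_le_pos) (auto simp: mult.commute)
qed

lemma contraction_modulus_least:
  assumes "\<And>x. infdist x (fixed_points F) \<le> R \<Longrightarrow>
             ereal (infdist (F x) (fixed_points F)) \<le> c * ereal (infdist x (fixed_points F))"
  shows "contraction_modulus F R \<le> c"
  unfolding contraction_modulus_def
proof (rule SUP_least)
  fix x assume "x \<in> {x. 0 < infdist x (fixed_points F) \<and> infdist x (fixed_points F) \<le> R}"
  then show "ereal (infdist (F x) (fixed_points F)) / ereal (infdist x (fixed_points F)) \<le> c"
    using assms[of x] by (subst ereal_divide_le_pos) (auto simp: mult.commute)
qed

lemma error_bound_modulus_upper: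
  assumes "continuous_on UNIV F" "fixed_points F \<noteq> {}" "infdist x (fixed_points F) \<le> R"
  shows "ereal (infdist x (fixed_points F)) \<le> error_bound_modulus F R * ereal (norm (F x - x))"
proof (cases "infdist x (fixed_points F) = 0")
  case True
  then show ?thesis using infdist_zero_imp_fixed[OF assms(1,2) True] by (simp flip: zero_ereal_def)
next
  case False
  then have pos: "0 < infdist x (fixed_points F)"
    using infdist_nonneg[of x "fixed_points F"] by linarith
  have "ereal (infdist x (fixed_points F)) / ereal (norm (F x - x)) \<le> error_bound_modulus F R"
    unfolding error_bound_modulus_def by (rule SUP_upper) (use pos assms in auto)
  then show ?thesis
    using infdist_pos_imp_not_fixed[OF pos]
    by (subst (asm) ereal_divide_le_pos) (auto simp: mult.commute)
qed

lemma error_bound_modulus_least: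
  assumes "\<And>x. infdist x (fixed_points F) \<le> R \<Longrightarrow>
             ereal (infdist x (fixed_points F)) \<le> c * ereal (norm (F x - x))"
  shows "error_bound_modulus F R \<le> c"
  unfolding error_bound_modulus_def
proof (rule SUP_least)
  fix x assume x: "x \<in> {x. 0 < infdist x (fixed_points F) \<and> infdist x (fixed_points F) \<le> R}"
  then have "0 < norm (F x - x)" using infdist_pos_imp_not_fixed by blast
  then show "ereal (infdist x (fixed_points F)) / ereal (norm (F x - x)) \<le> c"
    using x assms[of x] by (subst ereal_divide_le_pos) (auto simp: mult.commute)
qed

text \<open>
  The bounds on one modulus in terms of the other are equivalent rearrangements,
  inequality by inequality, for arbitrary values \<open>r\<close> and \<open>k\<close>.
\<close>

lemma lower_bound_iff_upper_bound:
  fixes r k :: ereal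
  assumes "0 \<le> r" "r \<le> 1" "0 < k"
  shows "1 - 1 / k \<le> r \<longleftrightarrow> k \<le> 1 / (1 - r)"
proof -
  obtain s where s: "r = ereal s" "0 \<le> s" "s \<le> 1"
    using assms(1,2) by (cases r) auto
  show ?thesis
  proof (cases k)
    case (real t)
    then have t: "0 < t" using assms(3) by simp
    show ?thesis
    proof (cases "s = 1")
      case True
      then show ?thesis using s real t by (simp add: one_ereal_def divide_ereal_def)
    next
      case False
      then have "0 < 1 - s" using s by simp
      moreover from this have "1 - 1 / t \<le> s \<longleftrightarrow> t \<le> 1 / (1 - s)"
        using t by (simp add: field_simps)
      ultimately show ?thesis using s real t by (simp add: one_ereal_def)
    qed
  next
    case PInf
    then show ?thesis using s by (auto simp: one_ereal_def)
  next
    case MInf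
    then show ?thesis using assms(3) by simp
  qed
qed

lemma sqrt_upper_bound_iff_sqrt_lower_bound:
  fixes r k :: ereal and \<alpha> :: real
  assumes "0 < \<alpha>" "\<alpha> < 1" "0 \<le> r" "r \<le> 1" "0 < k"
  shows "r \<le> esqrt (1 - ereal (1 - \<alpha>) / (ereal \<alpha> * k\<^sup>2)) \<longleftrightarrow>
         esqrt (ereal (1 - \<alpha>) / (ereal \<alpha> * (1 - r\<^sup>2))) \<le> k"
proof -
  obtain s where s: "r = ereal s" "0 \<le> s" "s \<le> 1"
    using assms(3,4) by (cases r) auto
  have s2: "s\<^sup>2 \<le> 1" using s by (simp add: power_le_one)
  show ?thesis
  proof (cases k)
    case (real t)
    then have t: "0 < t" using assms(5) by simp
    have sq: "x \<le> sqrt y \<longleftrightarrow> x\<^sup>2 \<le> y" if "0 \<le> x" for x y :: real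
      using that real_le_rsqrt real_sqrt_ge_zero
      by (smt (verit) real_sqrt_abs real_sqrt_le_iff power2_eq_square)
    have sq': "sqrt y \<le> t \<longleftrightarrow> y \<le> t\<^sup>2" for y :: real
      using t by (smt (verit) real_sqrt_abs real_sqrt_le_iff)
    show ?thesis
    proof (cases "s = 1")
      case True
      have "0 < (1 - \<alpha>) / (\<alpha> * t\<^sup>2)" using assms(1,2) t by simp
      then have "\<not> 1 \<le> sqrt (1 - (1 - \<alpha>) / (\<alpha> * t\<^sup>2))" by simp
      moreover have "ereal (1 - \<alpha>) / 0 = \<infinity>" using assms(2) by (simp add: divide_ereal_def)
      ultimately show ?thesis using True s real t by (simp add: one_ereal_def)
    next
      case False
      then have "s\<^sup>2 < 1" using s by (simp add: power_less_one_iff abs_square_less_1)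
      then have p: "0 < 1 - s\<^sup>2" by simp
      have "s \<le> sqrt (1 - (1 - \<alpha>) / (\<alpha> * t\<^sup>2)) \<longleftrightarrow> s\<^sup>2 \<le> 1 - (1 - \<alpha>) / (\<alpha> * t\<^sup>2)"
        using sq s by simp
      also have "\<dots> \<longleftrightarrow> (1 - \<alpha>) / (\<alpha> * (1 - s\<^sup>2)) \<le> t\<^sup>2"
        using p t assms(1) by (simp add: field_simps)
      also have "\<dots> \<longleftrightarrow> sqrt ((1 - \<alpha>) / (\<alpha> * (1 - s\<^sup>2))) \<le> t"
        using sq' by simp
      finally show ?thesis using s real t p assms(1) by (simp add: one_ereal_def)
    qed
  next
    case PInf
    then show ?thesis using s assms(1) by (simp add: one_ereal_def)
  next
    case MInf
    then show ?thesis using assms(5) by simp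
  qed
qed

end

theory Submission
  imports Defs
begin

text \<open>
  Write \<open>d\<close> for the distance to the fixed point set. Two pointwise estimates carry the proof.
  The triangle inequality \<open>d x \<le> \<parallel>F x - x\<parallel> + d (F x)\<close> turns a contraction of \<open>d\<close> by the
  factor \<open>\<rho> < 1\<close> into the error bound \<open>(1 - \<rho>) * d x \<le> \<parallel>F x - x\<parallel>\<close>; this is
  \<open>error_bound_le_contraction\<close>. In the other direction, an averaged operator decreases the
  squared distance to every fixed point by at least \<open>(1 - \<alpha>) / \<alpha> * \<parallel>F x - x\<parallel>\<^sup>2\<close>
  (\<open>averaged_dist_fixed_point\<close>). Applied to the fixed point nearest to \<open>x\<close>, this bounds
  \<open>(d (F x))\<^sup>2\<close> by \<open>(d x)\<^sup>2\<close> minus that amount, and an error bound with constant \<open>K\<close> makes the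
  amount at least \<open>(1 - \<alpha>) / (\<alpha> * K\<^sup>2) * (d x)\<^sup>2\<close>; this is \<open>contraction_le_error_bound\<close>.

  The remaining two inequalities are algebraic rearrangements of these. They require
  \<open>0 \<le> \<rho> \<le> 1\<close> and \<open>K > 0\<close>, hence that the suprema are not over the empty set: an
  operator other than the identity has nonfixed points arbitrarily close to its fixed points
  (\<open>near_nonfixed_point\<close>).
\<close>

text \<open>
  With \<open>u = x - p\<close> and \<open>v = N x - p\<close>, the norm of a convex combination satisfies
  \<open>\<parallel>(1 - \<alpha>) u + \<alpha> v\<parallel>\<^sup>2 = (1 - \<alpha>) \<parallel>u\<parallel>\<^sup>2 + \<alpha> \<parallel>v\<parallel>\<^sup>2 - \<alpha> (1 - \<alpha>) \<parallel>v - u\<parallel>\<^sup>2\<close>;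
  nonexpansiveness gives \<open>\<parallel>v\<parallel> \<le> \<parallel>u\<parallel>\<close>, and \<open>F x - x = \<alpha> (v - u)\<close>.
\<close>

lemma averaged_dist_fixed_point:
  fixes F :: "'a::real_inner \<Rightarrow> 'a"
  assumes "0 < \<alpha>" "averaged \<alpha> F" "F p = p"
  shows "(norm (F x - p))\<^sup>2 \<le> (norm (x - p))\<^sup>2 - (1 - \<alpha>) / \<alpha> * (norm (F x - x))\<^sup>2"
proof -
  obtain N where N: "nonexpansive N" "\<And>x. F x = (1 - \<alpha>) *\<^sub>R x + \<alpha> *\<^sub>R N x"
    using assms(2) by (auto simp: averaged_def)
  have "\<alpha> *\<^sub>R N p = \<alpha> *\<^sub>R p"
    using N(2)[of p] unfolding assms(3)
    by (metis add_diff_cancel_left' scaleR_add_left scaleR_one diff_add_cancel)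
  then have Np: "N p = p" using assms(1) by simp
  define u v where "u = x - p" and "v = N x - p"
  have "norm v \<le> norm u"
    using N(1) Np unfolding nonexpansive_def u_def v_def by metis
  then have vu: "v \<bullet> v \<le> u \<bullet> u" by (simp add: norm_le)
  have Fp: "F x - p = (1 - \<alpha>) *\<^sub>R u + \<alpha> *\<^sub>R v" and Fx: "F x - x = \<alpha> *\<^sub>R (v - u)"
    by (simp_all add: N(2) u_def v_def algebra_simps)
  have "(norm (F x - p))\<^sup>2 = (1 - \<alpha>) * (u \<bullet> u) + \<alpha> * (v \<bullet> v) - \<alpha> * (1 - \<alpha>) * ((v - u) \<bullet> (v - u))"
    unfolding Fp power2_norm_eq_inner
    by (simp add: inner_simps inner_commute[of v u]) (simp add: algebra_simps)
  also have "\<dots> \<le> u \<bullet> u - \<alpha> * (1 - \<alpha>) * ((v - u) \<bullet> (v - u))"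
    using mult_left_mono[OF vu, of \<alpha>] assms(1) by (simp add: algebra_simps)
  also have "\<alpha> * (1 - \<alpha>) * ((v - u) \<bullet> (v - u)) = (1 - \<alpha>) / \<alpha> * (norm (F x - x))\<^sup>2"
    unfolding Fx power2_norm_eq_inner using assms(1) by simp
  finally show ?thesis by (simp add: u_def power2_norm_eq_inner)
qed

lemma closed_fixed_points:
  fixes F :: "'a::t2_space \<Rightarrow> 'a"
  assumes "continuous_on UNIV F"
  shows "closed (fixed_points F)"
  unfolding fixed_points_def by (intro closed_Collect_eq assms continuous_on_id)

text \<open>
  The decrease towards a single fixed point becomes one of the distance to the whole set by
  choosing the fixed point nearest to \<open>x\<close>, which exists by closedness.
\<close>

lemma averaged_infdist_fixed_points:
  fixes F :: "'a::euclidean_space \<Rightarrow> 'a"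
  assumes "0 < \<alpha>" "averaged \<alpha> F" "continuous_on UNIV F" "fixed_points F \<noteq> {}"
  shows "(infdist (F x) (fixed_points F))\<^sup>2
    \<le> (infdist x (fixed_points F))\<^sup>2 - (1 - \<alpha>) / \<alpha> * (norm (F x - x))\<^sup>2"
proof -
  obtain p where p: "p \<in> fixed_points F" "infdist x (fixed_points F) = dist x p"
    using infdist_attains_inf[OF closed_fixed_points[OF assms(3)] assms(4)] by blast
  have "(infdist (F x) (fixed_points F))\<^sup>2 \<le> (norm (F x - p))\<^sup>2"
    using infdist_le[OF p(1), of "F x"] by (simp add: dist_norm infdist_nonneg power_mono)
  also have "\<dots> \<le> (norm (x - p))\<^sup>2 - (1 - \<alpha>) / \<alpha> * (norm (F x - x))\<^sup>2"
    using averaged_dist_fixed_point[OF assms(1,2)] p(1) by (simp add: fixed_points_def)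
  finally show ?thesis by (simp add: p(2) dist_norm)
qed

text \<open>
  On the segment from a nonfixed point \<open>y\<close> to its nearest fixed point \<open>p\<close>, take a point
  other than \<open>p\<close> within distance \<open>R\<close> of \<open>p\<close>. It is strictly closer to \<open>y\<close> than \<open>p\<close> is, so
  it cannot be in the fixed point set, to which \<open>y\<close> has the distance \<open>\<parallel>y - p\<parallel>\<close>.
\<close>

lemma near_nonfixed_point:
  fixes F :: "'a::euclidean_space \<Rightarrow> 'a"
  assumes "continuous_on UNIV F" "fixed_points F \<noteq> {}" "F \<noteq> id" "0 < R"
  obtains x where "0 < infdist x (fixed_points F)" "infdist x (fixed_points F) \<le> R"
proof -
  obtain y where "F y \<noteq> y" using assms(3) by (auto simp: fun_eq_iff)
  then have pos: "0 < infdist y (fixed_points F)"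
    using infdist_zero_imp_fixed[OF assms(1,2), of y] infdist_nonneg[of y "fixed_points F"]
    by linarith
  obtain p where p: "p \<in> fixed_points F" "infdist y (fixed_points F) = dist y p"
    using infdist_attains_inf[OF closed_fixed_points[OF assms(1)] assms(2)] by blast
  define t where "t = min 1 (R / dist y p)"
  have t: "0 < t" "t \<le> 1" "t * dist y p \<le> R"
    using pos p(2) assms(4) by (auto simp: t_def min_def field_simps)
  define x where "x = p + t *\<^sub>R (y - p)"
  have xp: "dist x p = t * dist y p"
    using t(1) by (simp add: x_def dist_norm)
  have "y - x = (1 - t) *\<^sub>R (y - p)"
    by (simp add: x_def algebra_simps)
  then have yx: "dist y x = (1 - t) * dist y p"
    using t(2) by (simp add: dist_norm)
  have "infdist y (fixed_points F) \<le> infdist x (fixed_points F) + dist y x"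
    by (rule infdist_triangle)
  then have "t * dist y p \<le> infdist x (fixed_points F)"
    using yx p(2) by (simp add: algebra_simps)
  moreover have "0 < t * dist y p" using t(1) pos p(2) by simp
  moreover have "infdist x (fixed_points F) \<le> R"
    using infdist_le[OF p(1), of x] xp t(3) by linarith
  ultimately show ?thesis by (intro that[of x]) auto
qed

lemma contraction_modulus_nonneg:
  assumes "0 < infdist x (fixed_points F)" "infdist x (fixed_points F) \<le> R"
  shows "0 \<le> contraction_modulus F R"
proof -
  have "0 \<le> ereal (infdist (F x) (fixed_points F)) / ereal (infdist x (fixed_points F))"
    using assms(1) by (simp add: infdist_nonneg)
  also have "\<dots> \<le> contraction_modulus F R"
    unfolding contraction_modulus_def by (rule SUP_upper) (use assms in auto)
  finally show ?thesis .
qed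

lemma contraction_modulus_le_1:
  fixes F :: "'a::euclidean_space \<Rightarrow> 'a"
  assumes "0 < \<alpha>" "\<alpha> < 1" "averaged \<alpha> F" "continuous_on UNIV F" "fixed_points F \<noteq> {}"
  shows "contraction_modulus F R \<le> 1"
proof (rule contraction_modulus_least)
  fix x
  have "0 \<le> (1 - \<alpha>) / \<alpha> * (norm (F x - x))\<^sup>2" using assms(1,2) by simp
  then have "(infdist (F x) (fixed_points F))\<^sup>2 \<le> (infdist x (fixed_points F))\<^sup>2"
    using averaged_infdist_fixed_points[OF assms(1,3,4,5), of x] by linarith
  then show "ereal (infdist (F x) (fixed_points F)) \<le> 1 * ereal (infdist x (fixed_points F))"
    using power2_le_imp_le[OF _ infdist_nonneg] by simp
qed

lemma error_bound_modulus_pos: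
  assumes "0 < infdist x (fixed_points F)" "infdist x (fixed_points F) \<le> R"
  shows "0 < error_bound_modulus F R"
proof -
  have "0 < ereal (infdist x (fixed_points F)) / ereal (norm (F x - x))"
    using assms(1) infdist_pos_imp_not_fixed[OF assms(1)] by simp
  also have "\<dots> \<le> error_bound_modulus F R"
    unfolding error_bound_modulus_def by (rule SUP_upper) (use assms in auto)
  finally show ?thesis .
qed

text \<open>
  Where \<open>F\<close> contracts the distance to the fixed points, the step \<open>F x - x\<close> must make up for
  the difference of the distances at \<open>x\<close> and \<open>F x\<close>.
\<close>

lemma error_bound_le_contraction:
  fixes F :: "'a::real_normed_vector \<Rightarrow> 'a"
  assumes "continuous_on UNIV F" "fixed_points F \<noteq> {}"
    and "0 \<le> contraction_modulus F R" "contraction_modulus F R \<le> 1"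
  shows "error_bound_modulus F R \<le> 1 / (1 - contraction_modulus F R)"
proof -
  obtain s where s: "contraction_modulus F R = ereal s" "s \<le> 1"
    using assms(3,4) by (cases "contraction_modulus F R") auto
  show ?thesis
  proof (cases "s = 1")
    case True
    then show ?thesis using s by (simp add: one_ereal_def divide_ereal_def)
  next
    case False
    then have s1: "0 < 1 - s" using s(2) by simp
    have "error_bound_modulus F R \<le> ereal (1 / (1 - s))"
    proof (rule error_bound_modulus_least)
      fix x assume x: "infdist x (fixed_points F) \<le> R"
      have "infdist (F x) (fixed_points F) \<le> s * infdist x (fixed_points F)"
        using contraction_modulus_upper[OF assms(1,2) x] s(1) by simp
      moreover have "infdist x (fixed_points F) \<le> infdist (F x) (fixed_points F) + dist x (F x)"
        by (rule infdist_triangle)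
      ultimately have "(1 - s) * infdist x (fixed_points F) \<le> norm (F x - x)"
        by (simp add: dist_norm norm_minus_commute algebra_simps)
      then show "ereal (infdist x (fixed_points F)) \<le> ereal (1 / (1 - s)) * ereal (norm (F x - x))"
        using s1 by (simp add: field_simps)
    qed
    then show ?thesis using s s1 by (simp add: one_ereal_def)
  qed
qed

text \<open>
  A finite error bound forces the step \<open>F x - x\<close>, and with it the decrease of the squared
  distance, to be at least proportional to the distance. If the error bound is infinite, the
  right hand side is \<open>1\<close>.
\<close>

lemma contraction_le_error_bound:
  fixes F :: "'a::euclidean_space \<Rightarrow> 'a"
  assumes "0 < \<alpha>" "\<alpha> < 1" "averaged \<alpha> F" "continuous_on UNIV F" "fixed_points F \<noteq> {}"
    and "0 < error_bound_modulus F R"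
  shows "contraction_modulus F R
    \<le> esqrt (1 - ereal (1 - \<alpha>) / (ereal \<alpha> * (error_bound_modulus F R)\<^sup>2))"
proof (cases "error_bound_modulus F R")
  case (real t)
  then have t: "0 < t" using assms(6) by simp
  define c where "c = 1 - (1 - \<alpha>) / (\<alpha> * t\<^sup>2)"
  have "contraction_modulus F R \<le> ereal (sqrt c)"
    unfolding contraction_modulus_def
  proof (rule SUP_least)
    fix x assume "x \<in> {x. 0 < infdist x (fixed_points F) \<and> infdist x (fixed_points F) \<le> R}"
    then have x: "0 < infdist x (fixed_points F)" "infdist x (fixed_points F) \<le> R" by auto
    let ?d = "infdist x (fixed_points F)" and ?d' = "infdist (F x) (fixed_points F)"
    have "?d \<le> t * norm (F x - x)"
      using error_bound_modulus_upper[OF assms(4,5) x(2)] real by simp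
    then have "?d\<^sup>2 \<le> (t * norm (F x - x))\<^sup>2"
      using x(1) by (intro power_mono) auto
    then have step: "?d\<^sup>2 / t\<^sup>2 \<le> (norm (F x - x))\<^sup>2"
      using t by (simp add: field_simps power_mult_distrib)
    have "?d'\<^sup>2 \<le> ?d\<^sup>2 - (1 - \<alpha>) / \<alpha> * (norm (F x - x))\<^sup>2"
      by (rule averaged_infdist_fixed_points[OF assms(1,3,4,5)])
    also have "\<dots> \<le> ?d\<^sup>2 - (1 - \<alpha>) / \<alpha> * (?d\<^sup>2 / t\<^sup>2)"
      using mult_left_mono[OF step, of "(1 - \<alpha>) / \<alpha>"] assms(1,2) by simp
    also have "\<dots> = c * ?d\<^sup>2"
      by (simp add: c_def algebra_simps)
    finally have "(?d' / ?d)\<^sup>2 \<le> c"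
      using x(1) by (simp add: power_divide divide_le_eq)
    then have "?d' / ?d \<le> sqrt c" by (rule real_le_rsqrt)
    then show "ereal ?d' / ereal ?d \<le> ereal (sqrt c)" using x(1) by simp
  qed
  then show ?thesis using real t assms(1) by (simp add: c_def one_ereal_def)
next
  case PInf
  then show ?thesis
    using contraction_modulus_le_1[OF assms(1-5)] assms(1) by (simp add: one_ereal_def)
next
  case MInf
  then show ?thesis using assms(6) by simp
qed

theorem corollary1:
  fixes F :: "real ^ 'n \<Rightarrow> real ^ 'n" and \<alpha> R :: real and \<rho> K :: ereal
  assumes "0 < \<alpha>" "\<alpha> < 1"
    and "continuous_on UNIV F" "averaged \<alpha> F"
    and "fixed_points F \<noteq> {}" "F \<noteq> id"
    and "0 < R"
    and "\<rho> = contraction_modulus F R" "K = error_bound_modulus F R"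
  shows "(0 \<le> \<rho> \<and> \<rho> \<le> 1 \<and> K \<noteq> -\<infinity>) \<and>
    (1 - 1 / K \<le> \<rho> \<and>
     \<rho> \<le> esqrt (1 - ereal (1 - \<alpha>) / (ereal \<alpha> * K\<^sup>2))) \<and>
    (esqrt (ereal (1 - \<alpha>) / (ereal \<alpha> * (1 - \<rho>\<^sup>2))) \<le> K \<and>
     K \<le> 1 / (1 - \<rho>))"
proof -
  obtain x where x: "0 < infdist x (fixed_points F)" "infdist x (fixed_points F) \<le> R"
    by (rule near_nonfixed_point[OF assms(3,5,6,7)])
  have \<rho>: "0 \<le> \<rho>" "\<rho> \<le> 1"
    using contraction_modulus_nonneg[OF x] contraction_modulus_le_1[OF assms(1,2,4,3,5)] assms(8)
    by simp_all
  have K: "0 < K" using error_bound_modulus_pos[OF x] assms(9) by simp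
  have upper_K: "K \<le> 1 / (1 - \<rho>)"
    using error_bound_le_contraction[OF assms(3,5)] \<rho> assms(8,9) by simp
  have upper_\<rho>: "\<rho> \<le> esqrt (1 - ereal (1 - \<alpha>) / (ereal \<alpha> * K\<^sup>2))"
    using contraction_le_error_bound[OF assms(1,2,4,3,5)] K assms(8,9) by simp
  have lower_\<rho>: "1 - 1 / K \<le> \<rho>"
    using upper_K lower_bound_iff_upper_bound[OF \<rho> K] by blast
  have lower_K: "esqrt (ereal (1 - \<alpha>) / (ereal \<alpha> * (1 - \<rho>\<^sup>2))) \<le> K"
    using upper_\<rho> sqrt_upper_bound_iff_sqrt_lower_bound[OF assms(1,2) \<rho> K] by blast
  have "K \<noteq> -\<infinity>" using K by auto
  then show ?thesis
    using \<rho> lower_\<rho> upper_\<rho> lower_K upper_K by blast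
qed

end
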